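(* Let $p$ be prime and let $\alpha=(\alpha_n)_{n\in\mathbb N}\in\Xi_p$ be irrational, with $p\alpha_{n+1}=\alpha_n+x_n$, $x_n\in\{0,\dots,p-1\}$ for all $n$, $\alpha_0\ne0$ and $x_0\neq0$. Let $\mathscr A_\beta^{\mathscr S}$ be the noncommutative solenoid, Morita equivalent to $\mathscr A_\alpha^{\mathscr S}$, formed by the directed system of equivalence bimodules construction using a projection $P\in A_{\alpha_0}$ with $\tau_{\alpha_0}(P)=\alpha_0$, and let $\mathscr A_{\beta'}^{\mathscr S}$ be the noncommutative solenoid, Morita equivalent to $\mathscr A_\alpha^{\mathscr S}$, given by the Heisenberg bimodule construction. Then these two noncommutative solenoids are the same, i.e. $\mathscr A_\beta^{\mathscr S}\cong\mathscr A_{\beta'}^{\mathscr S}$.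
   Context: $\mathbb N$ includes $0$; empty sums are $0$. $\Xi_p$ is the set of real sequences $(\alpha_n)_{n\in\mathbb N}$ with $\alpha_0\in[0,1)$ and, for each $n$, $p\alpha_{n+1}=\alpha_n+x_n$ with $x_n\in\{0,\dots,p-1\}$. $\Omega_p$ is the set of real sequences with $p\alpha_{n+1}-\alpha_n\in\mathbb Z$ for all $n$. $A_\theta$ is the universal C*-algebra generated by unitaries $U_\theta,V_\theta$ with $U_\theta V_\theta=e^{2\pi i\theta}V_\theta U_\theta$; $\tau_\theta$ is its unique tracial state for irrational $\theta$. For $\beta\in\Omega_p$, the noncommutative solenoid $\mathscr A_\beta^{\mathscr S}$ is the direct limit of $A_{\beta_0}\to A_{\beta_2}\to A_{\beta_4}\to\cdots$ with connecting maps sending $U,V$ to the $p$-th powers of the corresponding generators; the even entries mod $\mathbb Z$ suffice to define it. Directed system construction with this $P$ (trace $c_0\alpha_0+d_0$ with $c_0=1$, $d_0=0$): put $c_{2n}=p^{2n}$, $d_{2n}=-\sum_{j=0}^{2n-1}x_jp^j$, choose integers $a_{2n},b_{2n}$ with $a_{2n}d_{2n}-b_{2n}c_{2n}=1$, and let $\beta_{2n}=\dfrac{a_{2n}\alpha_{2n}+b_{2n}}{c_{2n}\alpha_{2n}+d_{2n}}$; these satisfy $p^2\beta_{2n+2}\equiv\beta_{2n}\bmod\mathbb Z$, and $\mathscr A_\beta^{\mathscr S}=\varinjlim A_{\beta_{2n}}$ (with $A_{\beta_{2n}}\cong PA_{\alpha_{2n}}P$). Heisenberg bimodule construction: since $x_0\ne0$,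 the $p$-adic integer $x_\alpha=\sum_{j\ge0}x_jp^j$ is invertible in $\mathbb Z_p$; write $x_\alpha^{-1}=\sum_{j\ge0}y_jp^j$ with $y_j\in\{0,\dots,p-1\}$. The resulting solenoid is $\mathscr A_{\beta'}^{\mathscr S}$ with $\beta'_n=\dfrac1{\alpha_0p^n}+\dfrac{\sum_{j=0}^{n-1}y_jp^j}{p^n}$, $n\in\mathbb N$. (It arises as $C^*(D^\perp,\overline\eta)$ from Rieffel's Heisenberg bimodule for the lattice $D=\{[(x_\alpha r_1,\alpha_0r_1),(r_2,r_2)]:r_i\in\mathbb Z[1/p]\}$ in $[\mathbb Q_p\times\mathbb R]^2$.) *)

theory Defs
  imports
    Complex_Main
    "HOL-Library.Nonpos_Ints"
    "HOL-Computational_Algebra.Primes"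
    "HOL-Algebra.Module"
begin

section \<open>Unital C*-algebras\<close>

record 'a cstar = "(complex, 'a) module" +
  adj :: "'a \<Rightarrow> 'a"
  cnorm :: "'a \<Rightarrow> real"

text \<open>
  Unital complex C*-algebras on an explicit carrier; as usual for universal constructions,
  the zero algebra is admitted.
\<close>

locale cstar_algebra = ring A for A :: "'a cstar" (structure) +
  assumes smult_closed: "x \<in> carrier A \<Longrightarrow> c \<odot> x \<in> carrier A"
    and smult_l_distr: "x \<in> carrier A \<Longrightarrow> (c + d) \<odot> x = c \<odot> x \<oplus> d \<odot> x"
    and smult_r_distr:
      "\<lbrakk>x \<in> carrier A; y \<in> carrier A\<rbrakk> \<Longrightarrow> c \<odot> (x \<oplus> y) = c \<odot> x \<oplus> c \<odot> y"
    and smult_assoc: "x \<in> carrier A \<Longrightarrow> (c * d) \<odot> x = c \<odot> (d \<odot> x)"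
    and smult_one: "x \<in> carrier A \<Longrightarrow> 1 \<odot> x = x"
    and smult_mult_l:
      "\<lbrakk>x \<in> carrier A; y \<in> carrier A\<rbrakk> \<Longrightarrow> (c \<odot> x) \<otimes> y = c \<odot> (x \<otimes> y)"
    and smult_mult_r:
      "\<lbrakk>x \<in> carrier A; y \<in> carrier A\<rbrakk> \<Longrightarrow> x \<otimes> (c \<odot> y) = c \<odot> (x \<otimes> y)"
    and adj_closed: "x \<in> carrier A \<Longrightarrow> adj A x \<in> carrier A"
    and adj_adj: "x \<in> carrier A \<Longrightarrow> adj A (adj A x) = x"
    and adj_add:
      "\<lbrakk>x \<in> carrier A; y \<in> carrier A\<rbrakk> \<Longrightarrow> adj A (x \<oplus> y) = adj A x \<oplus> adj A y"
    and adj_smult: "x \<in> carrier A \<Longrightarrow> adj A (c \<odot> x) = cnj c \<odot> adj A x"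
    and adj_mult:
      "\<lbrakk>x \<in> carrier A; y \<in> carrier A\<rbrakk> \<Longrightarrow> adj A (x \<otimes> y) = adj A y \<otimes> adj A x"
    and cnorm_nonneg: "x \<in> carrier A \<Longrightarrow> 0 \<le> cnorm A x"
    and cnorm_eq_0: "x \<in> carrier A \<Longrightarrow> cnorm A x = 0 \<longleftrightarrow> x = \<zero>"
    and cnorm_triangle:
      "\<lbrakk>x \<in> carrier A; y \<in> carrier A\<rbrakk> \<Longrightarrow> cnorm A (x \<oplus> y) \<le> cnorm A x + cnorm A y"
    and cnorm_smult: "x \<in> carrier A \<Longrightarrow> cnorm A (c \<odot> x) = cmod c * cnorm A x"
    and cnorm_mult:
      "\<lbrakk>x \<in> carrier A; y \<in> carrier A\<rbrakk> \<Longrightarrow> cnorm A (x \<otimes> y) \<le> cnorm A x * cnorm A y"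
    and cnorm_cstar: "x \<in> carrier A \<Longrightarrow> cnorm A (adj A x \<otimes> x) = (cnorm A x)\<^sup>2"
    and cnorm_complete:
      "\<lbrakk>\<And>n :: nat. s n \<in> carrier A;
        \<And>e. e > 0 \<Longrightarrow> \<exists>N. \<forall>m\<ge>N. \<forall>n\<ge>N. cnorm A (s m \<ominus> s n) < e\<rbrakk>
       \<Longrightarrow> \<exists>l\<in>carrier A. (\<lambda>n. cnorm A (s n \<ominus> l)) \<longlonglongrightarrow> 0"

definition star_hom :: "'a cstar \<Rightarrow> 'b cstar \<Rightarrow> ('a \<Rightarrow> 'b) set" where
  "star_hom A B = {h \<in> ring_hom A B.
     (\<forall>c. \<forall>x\<in>carrier A. h (c \<odot>\<^bsub>A\<^esub> x) = c \<odot>\<^bsub>B\<^esub> h x) \<and>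
     (\<forall>x\<in>carrier A. h (adj A x) = adj B (h x))}"

definition star_isomorphic :: "'a cstar \<Rightarrow> 'b cstar \<Rightarrow> bool" where
  "star_isomorphic A B \<longleftrightarrow> (\<exists>h\<in>star_hom A B. bij_betw h (carrier A) (carrier B))"

definition unitary_elt :: "'a cstar \<Rightarrow> 'a \<Rightarrow> bool" where
  "unitary_elt A u \<longleftrightarrow>
     u \<in> carrier A \<and> adj A u \<otimes>\<^bsub>A\<^esub> u = \<one>\<^bsub>A\<^esub> \<and> u \<otimes>\<^bsub>A\<^esub> adj A u = \<one>\<^bsub>A\<^esub>"

definition projection_elt :: "'a cstar \<Rightarrow> 'a \<Rightarrow> bool" where
  "projection_elt A P \<longleftrightarrow> P \<in> carrier A \<and> adj A P = P \<and> P \<otimes>\<^bsub>A\<^esub> P = P"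

definition tracial_state :: "'a cstar \<Rightarrow> ('a \<Rightarrow> complex) \<Rightarrow> bool" where
  "tracial_state A \<tau> \<longleftrightarrow>
     (\<forall>x\<in>carrier A. \<forall>y\<in>carrier A. \<tau> (x \<oplus>\<^bsub>A\<^esub> y) = \<tau> x + \<tau> y) \<and>
     (\<forall>c. \<forall>x\<in>carrier A. \<tau> (c \<odot>\<^bsub>A\<^esub> x) = c * \<tau> x) \<and>
     (\<forall>x\<in>carrier A. \<tau> (adj A x \<otimes>\<^bsub>A\<^esub> x) \<in> \<real>\<^sub>\<ge>\<^sub>0) \<and>
     \<tau> \<one>\<^bsub>A\<^esub> = 1 \<and>
     (\<forall>x\<in>carrier A. \<forall>y\<in>carrier A. \<tau> (x \<otimes>\<^bsub>A\<^esub> y) = \<tau> (y \<otimes>\<^bsub>A\<^esub> x))"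

section \<open>Rotation algebras and direct limits\<close>

definition rotation_pair :: "real \<Rightarrow> 'a cstar \<Rightarrow> 'a \<Rightarrow> 'a \<Rightarrow> bool" where
  "rotation_pair \<theta> A u v \<longleftrightarrow> unitary_elt A u \<and> unitary_elt A v \<and>
     u \<otimes>\<^bsub>A\<^esub> v = exp (2 * of_real pi * \<i> * of_real \<theta>) \<odot>\<^bsub>A\<^esub> (v \<otimes>\<^bsub>A\<^esub> u)"

text \<open>
  The next two notions are universal properties, hence determine their objects up to
  isomorphism.  HOL cannot quantify over types, so the test algebras \<open>B\<close> have their carriers
  in the type of the algebra under consideration.  This is no restriction once that type has
  at least the cardinality of the continuum: the generated algebras and the limits below are
  separable, so every test map has its values in a separable, hence at most continuum-sized,
  unital C*-subalgebra, of which there is a copy in the type.  Such types also contain copies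
  of all the algebras at issue.

  Homomorphisms are compared on the carrier only, since functions are total.  Uniqueness
  expresses that \<open>U\<close>, \<open>V\<close> generate (respectively, that the images of the \<open>A n\<close> are jointly
  dense).
\<close>

definition rotation_algebra :: "real \<Rightarrow> 'a cstar \<Rightarrow> 'a \<Rightarrow> 'a \<Rightarrow> bool" where
  "rotation_algebra \<theta> A U V \<longleftrightarrow> cstar_algebra A \<and> rotation_pair \<theta> A U V \<and>
     (\<forall>(B :: 'a cstar) u v. cstar_algebra B \<and> rotation_pair \<theta> B u v \<longrightarrow>
       (\<exists>h\<in>star_hom A B. h U = u \<and> h V = v \<and>
          (\<forall>h'\<in>star_hom A B. h' U = u \<and> h' V = v \<longrightarrow> (\<forall>a\<in>carrier A. h' a = h a))))"

definition cocone ::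
    "(nat \<Rightarrow> 'a cstar) \<Rightarrow> (nat \<Rightarrow> 'a \<Rightarrow> 'a) \<Rightarrow> 'a cstar \<Rightarrow> (nat \<Rightarrow> 'a \<Rightarrow> 'a) \<Rightarrow> bool" where
  "cocone A \<phi> B \<kappa> \<longleftrightarrow>
     (\<forall>n. \<kappa> n \<in> star_hom (A n) B \<and> (\<forall>a\<in>carrier (A n). \<kappa> (Suc n) (\<phi> n a) = \<kappa> n a))"

definition direct_limit ::
    "(nat \<Rightarrow> 'a cstar) \<Rightarrow> (nat \<Rightarrow> 'a \<Rightarrow> 'a) \<Rightarrow> 'a cstar \<Rightarrow> (nat \<Rightarrow> 'a \<Rightarrow> 'a) \<Rightarrow> bool" where
  "direct_limit A \<phi> L \<iota> \<longleftrightarrow> cstar_algebra L \<and> cocone A \<phi> L \<iota> \<and>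
     (\<forall>(B :: 'a cstar) \<kappa>. cstar_algebra B \<and> cocone A \<phi> B \<kappa> \<longrightarrow>
       (\<exists>h\<in>star_hom L B. (\<forall>n. \<forall>a\<in>carrier (A n). h (\<iota> n a) = \<kappa> n a) \<and>
          (\<forall>h'\<in>star_hom L B. (\<forall>n. \<forall>a\<in>carrier (A n). h' (\<iota> n a) = \<kappa> n a) \<longrightarrow>
             (\<forall>b\<in>carrier L. h' b = h b))))"

section \<open>Noncommutative solenoids\<close>

definition Xi :: "nat \<Rightarrow> (nat \<Rightarrow> real) set" where
  "Xi p = {\<alpha>. \<alpha> 0 \<in> {0..<1} \<and>
     (\<forall>n. \<exists>x::nat. x \<in> {0..<p} \<and> real p * \<alpha> (Suc n) = \<alpha> n + real x)}"

definition Omega :: "nat \<Rightarrow> (nat \<Rightarrow> real) set" where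
  "Omega p = {\<alpha>. \<forall>n. real p * \<alpha> (Suc n) - \<alpha> n \<in> \<int>}"

definition nc_solenoid :: "nat \<Rightarrow> (nat \<Rightarrow> real) \<Rightarrow> 'a cstar \<Rightarrow> bool" where
  "nc_solenoid p \<beta> S \<longleftrightarrow> \<beta> \<in> Omega p \<and>
     (\<exists>A U V \<phi> \<iota>.
        (\<forall>n. rotation_algebra (\<beta> (2 * n)) (A n) (U n) (V n)) \<and>
        (\<forall>n. \<phi> n \<in> star_hom (A n) (A (Suc n)) \<and>
             \<phi> n (U n) = U (Suc n) [^]\<^bsub>A (Suc n)\<^esub> p \<and>
             \<phi> n (V n) = V (Suc n) [^]\<^bsub>A (Suc n)\<^esub> p) \<and>
        direct_limit A \<phi> S \<iota>)"

text \<open>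
  The integers \<open>c\<close> and \<open>d\<close> below are those for which \<open>c * \<alpha> (2 * n) + d\<close> is the trace
  \<open>\<alpha> 0\<close> of the projection \<open>P\<close> in the algebra with parameter \<open>\<alpha> (2 * n)\<close>.
  The integers \<open>a\<close>, \<open>b\<close> may be chosen freely for each \<open>n\<close>.  Only the even entries
  of \<open>\<beta>\<close> are prescribed.
\<close>

definition directed_system_parameter ::
    "nat \<Rightarrow> (nat \<Rightarrow> real) \<Rightarrow> (nat \<Rightarrow> nat) \<Rightarrow> (nat \<Rightarrow> real) \<Rightarrow> bool" where
  "directed_system_parameter p \<alpha> x \<beta> \<longleftrightarrow>
     (\<forall>n. \<exists>a b c d :: int.
        c = int p ^ (2 * n) \<and> d = - (\<Sum>j<2 * n. int (x j) * int p ^ j) \<and>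
        a * d - b * c = 1 \<and>
        \<beta> (2 * n) = (of_int a * \<alpha> (2 * n) + of_int b) / (of_int c * \<alpha> (2 * n) + of_int d))"

text \<open>
  The ring of p-adic integers as the inverse limit of the rings of integers modulo
  \<open>p ^ n\<close>: an element is its sequence of residues, reduced to \<open>{0..<p ^ n}\<close>.
\<close>

definition padic_ints :: "nat \<Rightarrow> (nat \<Rightarrow> int) ring" where
  "padic_ints p =
     \<lparr>carrier = {r. \<forall>n. r n \<in> {0..<int p ^ n} \<and> r (Suc n) mod int p ^ n = r n},
      mult = (\<lambda>r s n. r n * s n mod int p ^ n),
      one = (\<lambda>n. 1 mod int p ^ n),
      zero = (\<lambda>n. 0),
      add = (\<lambda>r s n. (r n + s n) mod int p ^ n)\<rparr>"

text \<open>The sum of the series with terms \<open>x j * p ^ j\<close>; terms with \<open>j \<ge> n\<close> vanish modulo \<open>p ^ n\<close>.\<close>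

definition padic_series :: "nat \<Rightarrow> (nat \<Rightarrow> nat) \<Rightarrow> nat \<Rightarrow> int" where
  "padic_series p x = (\<lambda>n. (\<Sum>j<n. int (x j) * int p ^ j) mod int p ^ n)"

definition inverse_digits :: "nat \<Rightarrow> (nat \<Rightarrow> nat) \<Rightarrow> (nat \<Rightarrow> nat) \<Rightarrow> bool" where
  "inverse_digits p x y \<longleftrightarrow>
     (\<forall>j. y j \<in> {0..<p}) \<and> padic_series p y = inv\<^bsub>padic_ints p\<^esub> (padic_series p x)"

definition heisenberg_parameter :: "nat \<Rightarrow> real \<Rightarrow> (nat \<Rightarrow> nat) \<Rightarrow> nat \<Rightarrow> real" where
  "heisenberg_parameter p t y n =
     1 / (t * real p ^ n) + (\<Sum>j<n. real (y j) * real p ^ j) / real p ^ n"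

end

theory Submission
  imports Defs "HOL-Number_Theory.Cong"
begin

text \<open>
  The two solenoids have opposite parameters modulo the integers, and opposite parameters
  give isomorphic solenoids.

  For the first claim write \<open>X = (\<Sum>j<2*n. x j * p ^ j)\<close>.  The recursion for \<open>\<alpha>\<close> telescopes to
  \<open>p ^ (2*n) * \<alpha> (2*n) = \<alpha> 0 + X\<close>, so the denominator of \<open>\<beta> (2*n)\<close> is \<open>\<alpha> 0\<close>, and the
  determinant condition turns the fraction into
  \<open>\<beta> (2*n) = a / p ^ (2*n) - 1 / (p ^ (2*n) * \<alpha> 0)\<close>.  Modulo \<open>p ^ (2*n)\<close> the determinant
  condition says that \<open>- a\<close> is inverse to \<open>X\<close>, which is exactly what the truncated
  p-adic inverse \<open>(\<Sum>j<2*n. y j * p ^ j)\<close> is.  Hence \<open>\<beta> (2*n)\<close> is, up to an integer, the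
  negative of the Heisenberg parameter (\<open>directed_system_heisenberg_sum_int\<close>); the freedom
  in the choice of \<open>a\<close> and \<open>b\<close> is absorbed by the integer.

  For the second claim, exchanging the two unitaries of a rotation pair negates its
  parameter.  So the universal property identifies the rotation algebras of the two directed
  systems level by level, by the maps that exchange the generators
  (\<open>rotation_algebra_opposite_iso\<close>).  These maps commute with the connecting maps because the
  latter raise both generators to the same power \<open>p\<close>; therefore they induce an isomorphism
  of the limits (\<open>direct_limit_isomorphic\<close>, \<open>nc_solenoid_opposite_isomorphic\<close>).
\<close>

section \<open>Star homomorphisms and rotation pairs\<close>

lemma star_homD:
  assumes "h \<in> star_hom A B"
  shows "x \<in> carrier A \<Longrightarrow> h x \<in> carrier B"
    and "\<lbrakk>x \<in> carrier A; y \<in> carrier A\<rbrakk> \<Longrightarrow> h (x \<otimes>\<^bsub>A\<^esub> y) = h x \<otimes>\<^bsub>B\<^esub> h y"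
    and "\<lbrakk>x \<in> carrier A; y \<in> carrier A\<rbrakk> \<Longrightarrow> h (x \<oplus>\<^bsub>A\<^esub> y) = h x \<oplus>\<^bsub>B\<^esub> h y"
    and "h \<one>\<^bsub>A\<^esub> = \<one>\<^bsub>B\<^esub>"
    and "x \<in> carrier A \<Longrightarrow> h (c \<odot>\<^bsub>A\<^esub> x) = c \<odot>\<^bsub>B\<^esub> h x"
    and "x \<in> carrier A \<Longrightarrow> h (adj A x) = adj B (h x)"
  using assms by (auto simp: star_hom_def ring_hom_def)

lemma star_hom_id: "(\<lambda>x. x) \<in> star_hom A A"
  by (auto simp: star_hom_def ring_hom_def)

lemma star_hom_comp:
  assumes "f \<in> star_hom A B" "g \<in> star_hom B C"
  shows "(\<lambda>x. g (f x)) \<in> star_hom A C"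
  using star_homD[OF assms(1)] star_homD[OF assms(2)]
  by (auto simp: star_hom_def ring_hom_def)

lemma star_hom_nat_pow:
  fixes k :: nat
  assumes h: "h \<in> star_hom A B" and A: "cstar_algebra A" and x: "x \<in> carrier A"
  shows "h (x [^]\<^bsub>A\<^esub> k) = h x [^]\<^bsub>B\<^esub> k"
proof -
  interpret A: cstar_algebra A by (rule A)
  show ?thesis
    by (induction k) (simp_all add: star_homD[OF h] x A.nat_pow_closed)
qed

lemma rotation_pair_carrier:
  assumes "rotation_pair \<theta> A u v"
  shows "u \<in> carrier A" "v \<in> carrier A"
  using assms by (auto simp: rotation_pair_def unitary_elt_def)

lemma unitary_elt_star_hom:
  assumes h: "h \<in> star_hom A B" and A: "cstar_algebra A" and u: "unitary_elt A u"
  shows "unitary_elt B (h u)"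
proof -
  interpret A: cstar_algebra A by (rule A)
  have c: "u \<in> carrier A" "adj A u \<in> carrier A"
    using u by (auto simp: unitary_elt_def A.adj_closed)
  then show ?thesis
    using u star_homD(2)[OF h, of u "adj A u"] star_homD(2)[OF h, of "adj A u" u]
    by (simp add: unitary_elt_def star_homD[OF h])
qed

lemma rotation_pair_star_hom:
  assumes h: "h \<in> star_hom A B" and A: "cstar_algebra A" and r: "rotation_pair \<theta> A u v"
  shows "rotation_pair \<theta> B (h u) (h v)"
proof -
  interpret A: cstar_algebra A by (rule A)
  note c = rotation_pair_carrier[OF r]
  have "h (u \<otimes>\<^bsub>A\<^esub> v) = h (exp (2 * of_real pi * \<i> * of_real \<theta>) \<odot>\<^bsub>A\<^esub> (v \<otimes>\<^bsub>A\<^esub> u))"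
    using r by (simp add: rotation_pair_def)
  then show ?thesis
    using r c unitary_elt_star_hom[OF h A] by (simp add: rotation_pair_def star_homD[OF h])
qed

text \<open>
  From \<open>u v = z v u\<close> one gets \<open>v u = z\<^sup>-\<^sup>1 u v\<close>, and inverting \<open>z = exp (2 \<pi> \<i> \<theta>)\<close> negates \<open>\<theta>\<close>, which
  matters only modulo the integers.
\<close>

lemma rotation_pair_swap:
  assumes A: "cstar_algebra A" and r: "rotation_pair \<theta> A u v" and int: "\<theta> + \<theta>' \<in> \<int>"
  shows "rotation_pair \<theta>' A v u"
proof -
  interpret A: cstar_algebra A by (rule A)
  note c = rotation_pair_carrier[OF r]
  let ?e = "\<lambda>t::real. exp (2 * of_real pi * \<i> * of_real t) :: complex"
  have "?e \<theta>' * ?e \<theta> = ?e (\<theta> + \<theta>')"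
    by (simp add: exp_add[symmetric] algebra_simps)
  also have "\<dots> = 1"
    using cis_multiple_2pi[OF int] by (simp add: cis_conv_exp mult_ac)
  finally have e: "?e \<theta>' * ?e \<theta> = 1" .
  have "?e \<theta>' \<odot>\<^bsub>A\<^esub> (u \<otimes>\<^bsub>A\<^esub> v) = ?e \<theta>' \<odot>\<^bsub>A\<^esub> (?e \<theta> \<odot>\<^bsub>A\<^esub> (v \<otimes>\<^bsub>A\<^esub> u))"
    using r by (simp add: rotation_pair_def)
  also have "\<dots> = (?e \<theta>' * ?e \<theta>) \<odot>\<^bsub>A\<^esub> (v \<otimes>\<^bsub>A\<^esub> u)"
    using c by (simp add: A.smult_assoc)
  also have "\<dots> = v \<otimes>\<^bsub>A\<^esub> u"
    unfolding e using c by (simp add: A.smult_one)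
  finally show ?thesis
    using r by (simp add: rotation_pair_def)
qed

section \<open>Opposite rotation algebras\<close>

lemma rotation_algebra_hom:
  fixes A B :: "'a cstar"
  assumes "rotation_algebra \<theta> A U V" "cstar_algebra B" "rotation_pair \<theta> B u v"
  obtains h where "h \<in> star_hom A B" "h U = u" "h V = v"
proof -
  have "\<exists>h\<in>star_hom A B. h U = u \<and> h V = v"
    using assms unfolding rotation_algebra_def by blast
  then show thesis using that by blast
qed

text \<open>
  The universal property only compares homomorphisms onto a prescribed rotation pair; the
  images of the generators are automatically such a pair.
\<close>

lemma rotation_algebra_hom_eq:
  fixes A B :: "'a cstar"
  assumes A: "rotation_algebra \<theta> A U V" and B: "cstar_algebra B"
    and f: "f \<in> star_hom A B" and g: "g \<in> star_hom A B"
    and eq: "f U = g U" "f V = g V" and a: "a \<in> carrier A"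
  shows "f a = g a"
proof -
  have "rotation_pair \<theta> B (g U) (g V)"
    using rotation_pair_star_hom[OF g] A by (auto simp: rotation_algebra_def)
  then obtain h where h: "\<forall>h'\<in>star_hom A B. h' U = g U \<and> h' V = g V \<longrightarrow> (\<forall>a\<in>carrier A. h' a = h a)"
    using A B unfolding rotation_algebra_def by blast
  have "f a = h a" using h f eq a by simp
  moreover have "g a = h a" using h g a by blast
  ultimately show ?thesis by simp
qed

lemma rotation_algebra_opposite_iso:
  fixes A B :: "'a cstar"
  assumes A: "rotation_algebra \<theta> A U V" and B: "rotation_algebra \<theta>' B U' V'"
    and int: "\<theta> + \<theta>' \<in> \<int>"
  obtains f g where "f \<in> star_hom A B" "f U = V'" "f V = U'"
    and "g \<in> star_hom B A"
    and "\<And>a. a \<in> carrier A \<Longrightarrow> g (f a) = a" "\<And>b. b \<in> carrier B \<Longrightarrow> f (g b) = b"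
proof -
  have cA: "cstar_algebra A" and cB: "cstar_algebra B"
    and rA: "rotation_pair \<theta> A U V" and rB: "rotation_pair \<theta>' B U' V'"
    using A B by (auto simp: rotation_algebra_def)
  have int': "\<theta>' + \<theta> \<in> \<int>" using int by (simp add: add.commute)
  obtain f where f: "f \<in> star_hom A B" "f U = V'" "f V = U'"
    using rotation_algebra_hom[OF A cB rotation_pair_swap[OF cB rB int']] .
  obtain g where g: "g \<in> star_hom B A" "g U' = V" "g V' = U"
    using rotation_algebra_hom[OF B cA rotation_pair_swap[OF cA rA int]] .
  have gf: "g (f a) = a" if "a \<in> carrier A" for a
    using rotation_algebra_hom_eq[OF A cA star_hom_comp[OF f(1) g(1)] star_hom_id _ _ that] f g
    by simp
  have fg: "f (g b) = b" if "b \<in> carrier B" for b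
    using rotation_algebra_hom_eq[OF B cB star_hom_comp[OF g(1) f(1)] star_hom_id _ _ that] f g
    by simp
  show thesis using that f g(1) gf fg by blast
qed

section \<open>Isomorphic directed systems\<close>

lemma direct_limit_hom:
  fixes A :: "nat \<Rightarrow> 'a cstar" and L B :: "'a cstar"
  assumes "direct_limit A \<phi> L \<iota>" "cstar_algebra B" "cocone A \<phi> B \<kappa>"
  obtains h where "h \<in> star_hom L B" "\<And>n a. a \<in> carrier (A n) \<Longrightarrow> h (\<iota> n a) = \<kappa> n a"
proof -
  have "\<exists>h\<in>star_hom L B. \<forall>n. \<forall>a\<in>carrier (A n). h (\<iota> n a) = \<kappa> n a"
    using assms unfolding direct_limit_def by blast
  then show thesis using that by blast
qed

lemma direct_limit_endo_eq_id:
  fixes A :: "nat \<Rightarrow> 'a cstar" and L :: "'a cstar"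
  assumes lim: "direct_limit A \<phi> L \<iota>" and f: "f \<in> star_hom L L"
    and eq: "\<And>n a. a \<in> carrier (A n) \<Longrightarrow> f (\<iota> n a) = \<iota> n a" and b: "b \<in> carrier L"
  shows "f b = b"
proof -
  have "cstar_algebra L \<and> cocone A \<phi> L \<iota>"
    using lim by (simp add: direct_limit_def)
  with lim obtain h where h: "\<forall>h'\<in>star_hom L L.
      (\<forall>n. \<forall>a\<in>carrier (A n). h' (\<iota> n a) = \<iota> n a) \<longrightarrow> (\<forall>b\<in>carrier L. h' b = h b)"
    unfolding direct_limit_def by blast
  have "f b = h b" using h f eq b by simp
  moreover have "b = h b" using bspec[OF h star_hom_id] b by simp
  ultimately show ?thesis by simp
qed

text \<open>
  A compatible family of homomorphisms between two directed systems turns the cocone of the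
  second limit into a cocone over the first system.
\<close>

lemma direct_limit_induced_hom:
  fixes A B :: "nat \<Rightarrow> 'a cstar" and L M :: "'a cstar"
  assumes L: "direct_limit A \<phi> L \<iota>" and M: "direct_limit B \<psi> M \<kappa>"
    and f: "\<And>n. f n \<in> star_hom (A n) (B n)"
    and comm: "\<And>n a. a \<in> carrier (A n) \<Longrightarrow> f (Suc n) (\<phi> n a) = \<psi> n (f n a)"
  obtains h where "h \<in> star_hom L M" "\<And>n a. a \<in> carrier (A n) \<Longrightarrow> h (\<iota> n a) = \<kappa> n (f n a)"
proof -
  have M': "cstar_algebra M" "cocone B \<psi> M \<kappa>"
    using M by (auto simp: direct_limit_def)
  then have "cocone A \<phi> M (\<lambda>n a. \<kappa> n (f n a))"
    using star_homD(1)[OF f] comm by (auto simp: cocone_def intro: star_hom_comp[OF f])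
  from direct_limit_hom[OF L M'(1) this] show thesis using that by blast
qed

lemma direct_limit_isomorphic:
  fixes A B :: "nat \<Rightarrow> 'a cstar" and L M :: "'a cstar"
  assumes L: "direct_limit A \<phi> L \<iota>" and M: "direct_limit B \<psi> M \<kappa>"
    and \<phi>: "\<And>n. \<phi> n \<in> star_hom (A n) (A (Suc n))"
    and f: "\<And>n. f n \<in> star_hom (A n) (B n)" and g: "\<And>n. g n \<in> star_hom (B n) (A n)"
    and gf: "\<And>n a. a \<in> carrier (A n) \<Longrightarrow> g n (f n a) = a"
    and fg: "\<And>n b. b \<in> carrier (B n) \<Longrightarrow> f n (g n b) = b"
    and comm: "\<And>n a. a \<in> carrier (A n) \<Longrightarrow> f (Suc n) (\<phi> n a) = \<psi> n (f n a)"
  shows "star_isomorphic L M"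
proof -
  have comm': "g (Suc n) (\<psi> n b) = \<phi> n (g n b)" if b: "b \<in> carrier (B n)" for n b
    using comm[OF star_homD(1)[OF g b]] gf[OF star_homD(1)[OF \<phi> star_homD(1)[OF g b]]] fg[OF b]
    by simp
  obtain h where h: "h \<in> star_hom L M"
      "\<And>n a. a \<in> carrier (A n) \<Longrightarrow> h (\<iota> n a) = \<kappa> n (f n a)"
    using direct_limit_induced_hom[where f = f, OF L M f comm] by blast
  obtain k where k: "k \<in> star_hom M L"
      "\<And>n b. b \<in> carrier (B n) \<Longrightarrow> k (\<kappa> n b) = \<iota> n (g n b)"
    using direct_limit_induced_hom[where f = g, OF M L g comm'] by blast
  have kh: "k (h a) = a" if "a \<in> carrier L" for a
    by (rule direct_limit_endo_eq_id[OF L star_hom_comp[OF h(1) k(1)] _ that])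
      (simp add: h k gf star_homD(1)[OF f])
  have hk: "h (k b) = b" if "b \<in> carrier M" for b
    by (rule direct_limit_endo_eq_id[OF M star_hom_comp[OF k(1) h(1)] _ that])
      (simp add: h k fg star_homD(1)[OF g])
  have "bij_betw h (carrier L) (carrier M)"
    by (rule bij_betw_byWitness[where f' = k])
      (use kh hk star_homD(1)[OF h(1)] star_homD(1)[OF k(1)] in auto)
  then show ?thesis using h(1) by (auto simp: star_isomorphic_def)
qed

theorem nc_solenoid_opposite_isomorphic:
  fixes S S' :: "'a cstar"
  assumes S: "nc_solenoid p \<beta> S" and S': "nc_solenoid p \<gamma> S'"
    and int: "\<And>n. \<beta> (2 * n) + \<gamma> (2 * n) \<in> \<int>"
  shows "star_isomorphic S S'"
proof -
  obtain A U V \<phi> \<iota> where A: "\<And>n. rotation_algebra (\<beta> (2 * n)) (A n) (U n) (V n)"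
    and \<phi>: "\<And>n. \<phi> n \<in> star_hom (A n) (A (Suc n))"
      "\<And>n. \<phi> n (U n) = U (Suc n) [^]\<^bsub>A (Suc n)\<^esub> p"
      "\<And>n. \<phi> n (V n) = V (Suc n) [^]\<^bsub>A (Suc n)\<^esub> p"
    and L: "direct_limit A \<phi> S \<iota>"
    using S unfolding nc_solenoid_def by blast
  obtain B U' V' \<psi> \<kappa> where B: "\<And>n. rotation_algebra (\<gamma> (2 * n)) (B n) (U' n) (V' n)"
    and \<psi>: "\<And>n. \<psi> n \<in> star_hom (B n) (B (Suc n))"
      "\<And>n. \<psi> n (U' n) = U' (Suc n) [^]\<^bsub>B (Suc n)\<^esub> p"
      "\<And>n. \<psi> n (V' n) = V' (Suc n) [^]\<^bsub>B (Suc n)\<^esub> p"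
    and M: "direct_limit B \<psi> S' \<kappa>"
    using S' unfolding nc_solenoid_def by blast
  have "\<forall>n. \<exists>f g. f \<in> star_hom (A n) (B n) \<and> f (U n) = V' n \<and> f (V n) = U' n \<and>
      g \<in> star_hom (B n) (A n) \<and> (\<forall>a\<in>carrier (A n). g (f a) = a) \<and>
      (\<forall>b\<in>carrier (B n). f (g b) = b)" (is "\<forall>n. \<exists>f g. ?iso n f g")
  proof
    fix n
    show "\<exists>f g. ?iso n f g"
      by (rule rotation_algebra_opposite_iso[OF A[of n] B[of n] int]) blast
  qed
  then obtain f g where "\<forall>n. ?iso n (f n) (g n)"
    unfolding choice_iff by (elim exE) (rule that)
  then have f: "\<And>n. f n \<in> star_hom (A n) (B n)"
      "\<And>n. f n (U n) = V' n" "\<And>n. f n (V n) = U' n"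
    and g: "\<And>n. g n \<in> star_hom (B n) (A n)"
    and gf: "\<And>n a. a \<in> carrier (A n) \<Longrightarrow> g n (f n a) = a"
    and fg: "\<And>n b. b \<in> carrier (B n) \<Longrightarrow> f n (g n b) = b"
    by simp_all
  have cA: "cstar_algebra (A n)" and cB: "cstar_algebra (B n)"
    and UV: "U n \<in> carrier (A n)" "V n \<in> carrier (A n)" for n
    using A[of n] B[of n] rotation_pair_carrier by (auto simp: rotation_algebra_def)
  \<comment> \<open>Both composites send \<open>U n\<close> to the \<open>p\<close>-th power of \<open>V' (Suc n)\<close> and \<open>V n\<close> to that of \<open>U' (Suc n)\<close>.\<close>
  have comm: "f (Suc n) (\<phi> n a) = \<psi> n (f n a)" if "a \<in> carrier (A n)" for n a
    by (rule rotation_algebra_hom_eq[OF A cB star_hom_comp[OF \<phi>(1) f(1)]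
          star_hom_comp[OF f(1) \<psi>(1)] _ _ that])
      (simp_all add: \<phi> \<psi> f star_hom_nat_pow[OF f(1) cA] UV)
  show ?thesis
    by (rule direct_limit_isomorphic[OF L M \<phi>(1) f(1) g gf fg comm])
qed

section \<open>Truncated p-adic inverses\<close>

lemma cong_inverse_unique:
  fixes a r s m :: int
  assumes "[a * r = 1] (mod m)" "[a * s = 1] (mod m)"
  shows "[r = s] (mod m)"
proof -
  have "coprime a m" using assms(1) coprime_iff_invertible_int by blast
  moreover have "[a * r = a * s] (mod m)"
    using assms by (meson cong_sym cong_trans)
  ultimately show ?thesis by (simp add: cong_mult_lcancel)
qed

text \<open>
  In the inverse limit, invertibility can be tested level by level: the inverses of the
  residues are compatible because inverses modulo \<open>p ^ n\<close> are unique.  This is what makes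
  \<open>inv\<close>, a definite description, denote an actual inverse.
\<close>

lemma padic_ints_inv_cong:
  assumes p: "p > 0" and r: "r \<in> carrier (padic_ints p)"
    and cop: "\<And>n. coprime (r n) (int p ^ n)"
  shows "[r n * (inv\<^bsub>padic_ints p\<^esub> r) n = 1] (mod int p ^ n)"
proof -
  have pos: "int p ^ n > 0" for n using p by simp
  have "\<exists>s. [r n * s = 1] (mod int p ^ n)" for n
    using cop[of n] by (simp add: coprime_iff_invertible_int)
  then obtain s0 where s0: "\<And>n. [r n * s0 n = 1] (mod int p ^ n)" by metis
  define s where "s n = s0 n mod int p ^ n" for n
  have s: "[r n * s n = 1] (mod int p ^ n)" for n
    using s0[of n] by (simp add: s_def cong_def mod_mult_right_eq)
  have comp: "s (Suc n) mod int p ^ n = s n" for n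
  proof -
    have dvd: "int p ^ n dvd int p ^ Suc n" by simp
    have "[r (Suc n) = r n] (mod int p ^ n)"
      using r by (simp add: padic_ints_def cong_def)
    then have "[r n * s (Suc n) = 1] (mod int p ^ n)"
      using cong_dvd_modulus[OF s[of "Suc n"] dvd] cong_scalar_right cong_sym cong_trans by metis
    from cong_inverse_unique[OF this s] show ?thesis
      by (simp add: cong_def s_def)
  qed
  have closed: "s \<in> carrier (padic_ints p)"
    using comp pos by (auto simp: padic_ints_def s_def)
  have one: "r \<otimes>\<^bsub>padic_ints p\<^esub> t = \<one>\<^bsub>padic_ints p\<^esub> \<longleftrightarrow>
      (\<forall>n. [r n * t n = 1] (mod int p ^ n))" for t
    by (simp add: padic_ints_def cong_def fun_eq_iff)
  have mult_comm: "s \<otimes>\<^bsub>padic_ints p\<^esub> r = r \<otimes>\<^bsub>padic_ints p\<^esub> s"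
    by (simp add: padic_ints_def mult.commute)
  have unique: "t = s" if t: "t \<in> carrier (padic_ints p)"
      "r \<otimes>\<^bsub>padic_ints p\<^esub> t = \<one>\<^bsub>padic_ints p\<^esub>" for t
  proof
    fix n
    have "[t n = s n] (mod int p ^ n)"
      using t(2) s cong_inverse_unique unfolding one by blast
    moreover have "t n \<in> {0..<int p ^ n}" using t(1) by (simp add: padic_ints_def)
    ultimately show "t n = s n" using pos by (simp add: cong_def s_def)
  qed
  have "r \<otimes>\<^bsub>padic_ints p\<^esub> s = \<one>\<^bsub>padic_ints p\<^esub>"
    using s one by blast
  then have "inv\<^bsub>padic_ints p\<^esub> r = s"
    unfolding m_inv_def
    using closed mult_comm by (intro the_equality conjI) (assumption | simp | blast intro: unique)+
  then show ?thesis using s by simp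
qed

lemma padic_series_carrier:
  assumes "p > 0"
  shows "padic_series p x \<in> carrier (padic_ints p)"
  using assms by (auto simp: padic_series_def padic_ints_def mod_mod_cancel)

lemma coprime_digit_sum_prime_power:
  assumes p: "prime p" and x0: "x 0 \<in> {0<..<p}"
  shows "coprime (\<Sum>j<n. int (x j) * int p ^ j) (int p ^ n)"
proof (cases n)
  case (Suc m)
  have "(\<Sum>j<n. int (x j) * int p ^ j) = int (x 0) + int p * (\<Sum>j<m. int (x (Suc j)) * int p ^ j)"
    unfolding Suc sum.lessThan_Suc_shift by (simp add: sum_distrib_left algebra_simps)
  moreover have "\<not> int p dvd int (x 0)"
    using x0 by (auto dest: dvd_imp_le)
  ultimately have "\<not> int p dvd (\<Sum>j<n. int (x j) * int p ^ j)"
    by (simp add: dvd_add_left_iff)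
  moreover have "prime (int p)" using p by simp
  ultimately show ?thesis
    by (metis coprime_commute coprime_power_right_iff prime_imp_coprime)
qed simp

lemma inverse_digits_cong:
  assumes p: "prime p" and x0: "x 0 \<in> {0<..<p}" and y: "inverse_digits p x y"
  shows "[(\<Sum>j<n. int (x j) * int p ^ j) * (\<Sum>j<n. int (y j) * int p ^ j) = 1] (mod int p ^ n)"
proof -
  have pos: "p > 0" using p by (simp add: prime_gt_0_nat)
  have "coprime (padic_series p x n) (int p ^ n)" for n
    using coprime_digit_sum_prime_power[of p x n, OF p x0] pos by (simp add: padic_series_def del: coprime_power_right_iff)
  from padic_ints_inv_cong[OF pos padic_series_carrier[OF pos] this]
  have "[padic_series p x n * padic_series p y n = 1] (mod int p ^ n)"
    using y by (simp add: inverse_digits_def)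
  then show ?thesis
    by (simp add: padic_series_def cong_def mod_mult_eq)
qed

section \<open>The two parameters\<close>

lemma digit_recursion_telescope:
  fixes \<alpha> :: "nat \<Rightarrow> real"
  assumes "\<And>n. real p * \<alpha> (Suc n) = \<alpha> n + real (x n)"
  shows "real p ^ n * \<alpha> n = \<alpha> 0 + (\<Sum>j<n. real (x j) * real p ^ j)"
proof (induction n)
  case (Suc n)
  have "real p ^ Suc n * \<alpha> (Suc n) = real p ^ n * (\<alpha> n + real (x n))"
    using assms[of n] by (simp add: mult_ac)
  then show ?case using Suc by (simp add: algebra_simps)
qed simp

lemma directed_system_heisenberg_sum_int:
  fixes \<alpha> \<beta> :: "nat \<Rightarrow> real"
  assumes p: "prime p" and x0: "x 0 \<in> {0<..<p}" and \<alpha>0: "\<alpha> 0 \<noteq> 0"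
    and rec: "\<And>n. real p * \<alpha> (Suc n) = \<alpha> n + real (x n)"
    and \<beta>: "directed_system_parameter p \<alpha> x \<beta>" and y: "inverse_digits p x y"
  shows "\<beta> (2 * n) + heisenberg_parameter p (\<alpha> 0) y (2 * n) \<in> \<int>"
proof -
  define X where "X = (\<Sum>j<2 * n. int (x j) * int p ^ j)"
  define Y where "Y = (\<Sum>j<2 * n. int (y j) * int p ^ j)"
  define q where "q = int p ^ (2 * n)"
  have "\<exists>a b c d. c = q \<and> d = - X \<and> a * d - b * c = 1 \<and>
      \<beta> (2 * n) = (of_int a * \<alpha> (2 * n) + of_int b) / (of_int c * \<alpha> (2 * n) + of_int d)"
    using \<beta> unfolding directed_system_parameter_def X_def q_def by (rule spec)
  then obtain a b c d where "c = q" "d = - X" "a * d - b * c = 1"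
      "\<beta> (2 * n) = (of_int a * \<alpha> (2 * n) + of_int b) / (of_int c * \<alpha> (2 * n) + of_int d)"
    by blast
  then have det: "a * (- X) - b * q = 1"
    and \<beta>n: "\<beta> (2 * n) = (of_int a * \<alpha> (2 * n) + of_int b) / (of_int q * \<alpha> (2 * n) + of_int (- X))"
    by simp_all
  have q: "real_of_int q \<noteq> 0" using p by (auto simp: q_def)
  have tel: "real_of_int q * \<alpha> (2 * n) = \<alpha> 0 + real_of_int X"
    using digit_recursion_telescope[of p \<alpha> x "2 * n", OF rec] by (simp add: q_def X_def)
  have det': "- real_of_int a * real_of_int X - real_of_int b * real_of_int q = 1"
    using arg_cong[OF det, of real_of_int] by simp
  have "\<beta> (2 * n) = (of_int a * \<alpha> (2 * n) + of_int b) / \<alpha> 0"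
    using \<beta>n tel by simp
  also have "\<dots> = (of_int a * (of_int q * \<alpha> (2 * n)) + of_int b * of_int q) / (of_int q * \<alpha> 0)"
    using q \<alpha>0 by (simp add: field_simps)
  also have "\<dots> = (of_int a * \<alpha> 0 - 1) / (of_int q * \<alpha> 0)"
    unfolding tel using det' by (simp add: algebra_simps)
  also have "\<dots> = of_int a / of_int q - 1 / (\<alpha> 0 * of_int q)"
    using q \<alpha>0 by (simp add: field_simps)
  finally have b: "\<beta> (2 * n) = of_int a / of_int q - 1 / (\<alpha> 0 * of_int q)" .
  have h: "heisenberg_parameter p (\<alpha> 0) y (2 * n) = 1 / (\<alpha> 0 * of_int q) + of_int Y / of_int q"
    by (simp add: heisenberg_parameter_def q_def Y_def)
  have inv_Y: "[X * Y = 1] (mod q)"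
    using inverse_digits_cong[of p x y "2 * n", OF p x0 y] by (simp add: X_def Y_def q_def)
  have "[X * (- a) = 1] (mod q)"
  proof -
    have "X * (- a) = 1 + q * b" using det by (simp add: algebra_simps)
    then show ?thesis by (simp add: cong_def)
  qed
  from cong_inverse_unique[OF inv_Y this] have "q dvd a + Y"
    by (simp add: cong_iff_dvd_diff add.commute)
  then obtain k where k: "a + Y = q * k" by (elim dvdE)
  have "\<beta> (2 * n) + heisenberg_parameter p (\<alpha> 0) y (2 * n) = real_of_int (a + Y) / real_of_int q"
    unfolding b h by (simp add: add_divide_distrib)
  also have "\<dots> = of_int k"
    unfolding k using q by simp
  finally show ?thesis by simp
qed

theorem proposition4p24:
  fixes p :: nat and \<alpha> \<beta> :: "nat \<Rightarrow> real" and x y :: "nat \<Rightarrow> nat"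
    and A S S' :: "'a cstar" and U V P :: 'a and \<tau> :: "'a \<Rightarrow> complex"
  assumes "prime p"
    and "\<alpha> \<in> Xi p"
    and "\<And>n. \<alpha> n \<notin> \<rat>"
    and "\<And>n. x n \<in> {0..<p}"
    and "\<And>n. real p * \<alpha> (Suc n) = \<alpha> n + real (x n)"
    and "\<alpha> 0 \<noteq> 0"
    and "x 0 \<noteq> 0"
    and "rotation_algebra (\<alpha> 0) A U V"
    and "tracial_state A \<tau>"
    and "projection_elt A P"
    and "\<tau> P = of_real (\<alpha> 0)"
    and "directed_system_parameter p \<alpha> x \<beta>"
    and "nc_solenoid p \<beta> S"
    and "inverse_digits p x y"
    and "nc_solenoid p (heisenberg_parameter p (\<alpha> 0) y) S'"
  shows "star_isomorphic S S'"
proof (rule nc_solenoid_opposite_isomorphic)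
  show "nc_solenoid p \<beta> S" "nc_solenoid p (heisenberg_parameter p (\<alpha> 0) y) S'"
    by fact+
next
  have x0: "x 0 \<in> {0<..<p}"
    using assms(4)[of 0] assms(7) by simp
  show "\<beta> (2 * n) + heisenberg_parameter p (\<alpha> 0) y (2 * n) \<in> \<int>" for n
    by (rule directed_system_heisenberg_sum_int) (use x0 assms in auto)
qed

end
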